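(* Let $t^*=(t_1^*,\dots,t_I^* )\in\{1,\dots,T\}^I$ be a given vector of revision times, and let $\{y_n^{MLP}\}_{n\in\mathcal T}$ be the optimal capacity allocation decisions of the linear programming relaxation of the multi-stage stochastic capacity expansion planning problem. Then $$V^{ATS}(t^* )-V^{MS}\ \le\ \sum_{i=1}^{I}\Big(v_i^R(t_i^* )-v_i^M+\max_{n\in\hat{\mathcal T}_i(t_i^* )}\{\lceil\hat\delta_{in}\rceil-\hat\delta_{in}\}\,a_{i1}\Big),$$ where $v_i^M$ and $v_i^R(t_i^* )$ are the optimal values of the linear programming relaxations of the multi-stage single-resource problem and of the adaptive two-stage single-resource problem with revision time $t_i^*$ for resource $i$, under $\delta_{in}=[A_ny_n^{MLP}]_i$.
   Context: $\mathcal T$ is a scenario tree with $T$ stages: a rooted tree (root denoted 1) whose nodes $n$ have period $t_n\in\{1,\dots,T\}$. $S_t$ is the set of nodes of period $t$; $P(n)$ is the set of nodes on the path from the root to $n$ (inclusive); $\mathcal T(n)$ is the subtree rooted at $n$. $p_n$ is the probability of (reaching) node $n$, with $\sum_{n\in S_t}p_n=1$ for each $t$. Multi-stage stochastic capacity expansion planning problem, with resources $\mathcal I$ ($I=|\mathcal I|$), tasks $\mathcal J$, items $\mathcal K$: $$\min\Big\{\sum_{n\in\mathcal T}p_n(a_n^\top x_n+b_n^\top y_n):\ A_ny_n\le\sum_{m\in P(n)}x_m,\ B_ny_n\ge d_n,\ x_n\in\mathbb Z_+^{|\mathcal I|},\ y_n\in\mathbb R_+^{|\mathcal J|}\ \forall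 n\in\mathcal T\Big\},$$ with $a_n\in\mathbb R_+^{|\mathcal I|}$, $b_n\in\mathbb R_+^{|\mathcal J|}$, $d_n\in\mathbb R_+^{|\mathcal K|}$; $x_n$ are capacity acquisition decisions and $y_n$ capacity allocation decisions. Its optimal value is $V^{MS}$. Adaptive two-stage version with revision decisions $t^*$: add, for each $i$, $x_{im}=x_{in}$ for all $m,n\in S_t$, $t<t_i^*$, and $x_{im}=x_{in}$ for all $m,n\in S_t\cap\mathcal T(j)$, $j\in S_{t_i^*}$, $t\ge t_i^*$; its optimal value is $V^{ATS}(t^* )$. Linear programming relaxations replace $\mathbb Z_+$ by $\mathbb R_+$. Single-resource problems for resource $i$ given $\{\delta_{in}\}_{n\in\mathcal T}$: (multi-stage) minimize $\sum_{n\in\mathcal T}p_na_{in}x_{in}$ subject to $\sum_{m\in P(n)}x_{im}\ge\delta_{in}$, $x_{in}\in\mathbb Z_+$ for all $n\in\mathcal T$; (adaptive two-stage) the same with the adaptive constraints for $i$ with $t_i^*$ added. Condensed tree: $\hat{\mathcal T}_i(t_i^* )$ is obtained from $\mathcal T$ by merging nodes forced to have equal $x_i$-decisions by the adaptive constraints: its nodes correspond to the sets $S_t$ for $t<t_i^*$, and $S_t\cap\mathcal T(j)$ for $j\in S_{t_i^*}$, $t\ge t_i^*$. If $\hat C_n\subset\mathcal T$ is the set merged into node $n\in\hat{\mathcal T}_i(t_i^* )$, then $\hat\delta_{in}=\max_{m\in\hat C_n}\delta_{im}$. $[\cdot]_i$ is the $i$-th component of a vector. *)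

theory Defs
  imports "HOL-Analysis.Analysis"
begin

record 'n stage_tree =
  nodes :: "'n set"
  root_node :: 'n
  parent :: "'n \<Rightarrow> 'n"
  period :: "'n \<Rightarrow> nat"
  stages :: nat
  prob :: "'n \<Rightarrow> real"

definition stage :: "'n stage_tree \<Rightarrow> nat \<Rightarrow> 'n set" where
  "stage \<T> t = {n \<in> nodes \<T>. period \<T> n = t}"

text \<open>Since the period increases by one along every edge, following parents from any node
  reaches the root; so the conditions below describe exactly a finite rooted tree, graded by depth.\<close>

definition scenario_tree :: "'n stage_tree \<Rightarrow> bool" where
  "scenario_tree \<T> \<longleftrightarrow>
     finite (nodes \<T>) \<and>
     root_node \<T> \<in> nodes \<T> \<and> period \<T> (root_node \<T>) = 1 \<and>
     (\<forall>n \<in> nodes \<T> - {root_node \<T>}.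
        parent \<T> n \<in> nodes \<T> \<and> period \<T> n = period \<T> (parent \<T> n) + 1) \<and>
     (\<forall>n \<in> nodes \<T>. period \<T> n \<in> {1..stages \<T>}) \<and>
     (\<forall>n \<in> nodes \<T>. 0 \<le> prob \<T> n) \<and>
     (\<forall>t \<in> {1..stages \<T>}. (\<Sum>n \<in> stage \<T> t. prob \<T> n) = 1)"

text \<open>A node of period \<open>t\<close> has \<open>t - 1\<close> proper ancestors, the last of which is the root.\<close>

definition path :: "'n stage_tree \<Rightarrow> 'n \<Rightarrow> 'n set" where
  "path \<T> n = {(parent \<T> ^^ k) n |k. k < period \<T> n}"

definition subtree :: "'n stage_tree \<Rightarrow> 'n \<Rightarrow> 'n set" where
  "subtree \<T> j = {n \<in> nodes \<T>. j \<in> path \<T> n}"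

abbreviation nonneg_ints :: "real set" ("\<int>\<^sub>+") where
  "\<int>\<^sub>+ \<equiv> {z \<in> \<int>. 0 \<le> z}"

abbreviation nonneg_reals :: "real set" ("\<real>\<^sub>+") where
  "\<real>\<^sub>+ \<equiv> {0..}"

text \<open>An infimum, so no attainment is presupposed; it is a meaningful optimal value when \<open>F\<close> is
  nonempty and \<open>f\<close> is bounded below on \<open>F\<close>.\<close>

definition opt_value :: "('s \<Rightarrow> real) \<Rightarrow> 's set \<Rightarrow> real" where
  "opt_value f F = (INF s \<in> F. f s)"

text \<open>The set \<open>D\<close> is the domain of the acquisition decisions: \<open>\<int>\<^sub>+\<close> for the problem itself
  and \<open>\<real>\<^sub>+\<close> for its linear programming relaxation.\<close>

definition expansion_cost ::
  "'n stage_tree \<Rightarrow> ('n \<Rightarrow> real^'i) \<Rightarrow> ('n \<Rightarrow> real^'j) \<Rightarrow>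
   ('n \<Rightarrow> real^'i) \<times> ('n \<Rightarrow> real^'j) \<Rightarrow> real" where
  "expansion_cost \<T> a b = (\<lambda>(x, y). \<Sum>n \<in> nodes \<T>. prob \<T> n * (a n \<bullet> x n + b n \<bullet> y n))"

definition expansion_feasible ::
  "real set \<Rightarrow> 'n stage_tree \<Rightarrow> ('n \<Rightarrow> real^'j^'i) \<Rightarrow> ('n \<Rightarrow> real^'j^'k) \<Rightarrow> ('n \<Rightarrow> real^'k) \<Rightarrow>
   (('n \<Rightarrow> real^'i) \<times> ('n \<Rightarrow> real^'j)) set" where
  "expansion_feasible D \<T> A B d =
     {(x, y). \<forall>n \<in> nodes \<T>.
        A n *v y n \<le> (\<Sum>m \<in> path \<T> n. x m) \<and> d n \<le> B n *v y n \<and>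
        (\<forall>i. x n $ i \<in> D) \<and> (\<forall>j. y n $ j \<in> \<real>\<^sub>+)}"

definition adaptive :: "'n stage_tree \<Rightarrow> nat \<Rightarrow> ('n \<Rightarrow> real) \<Rightarrow> bool" where
  "adaptive \<T> \<tau> z \<longleftrightarrow>
     (\<forall>t < \<tau>. \<forall>m \<in> stage \<T> t. \<forall>n \<in> stage \<T> t. z m = z n) \<and>
     (\<forall>t \<ge> \<tau>. \<forall>j \<in> stage \<T> \<tau>.
        \<forall>m \<in> stage \<T> t \<inter> subtree \<T> j. \<forall>n \<in> stage \<T> t \<inter> subtree \<T> j. z m = z n)"

definition V_MS ::
  "'n stage_tree \<Rightarrow> ('n \<Rightarrow> real^'i) \<Rightarrow> ('n \<Rightarrow> real^'j) \<Rightarrow>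
   ('n \<Rightarrow> real^'j^'i) \<Rightarrow> ('n \<Rightarrow> real^'j^'k) \<Rightarrow> ('n \<Rightarrow> real^'k) \<Rightarrow> real" where
  "V_MS \<T> a b A B d = opt_value (expansion_cost \<T> a b) (expansion_feasible \<int>\<^sub>+ \<T> A B d)"

definition V_ATS ::
  "'n stage_tree \<Rightarrow> ('n \<Rightarrow> real^'i) \<Rightarrow> ('n \<Rightarrow> real^'j) \<Rightarrow>
   ('n \<Rightarrow> real^'j^'i) \<Rightarrow> ('n \<Rightarrow> real^'j^'k) \<Rightarrow> ('n \<Rightarrow> real^'k) \<Rightarrow> ('i \<Rightarrow> nat) \<Rightarrow> real" where
  "V_ATS \<T> a b A B d \<tau> =
     opt_value (expansion_cost \<T> a b)
       {(x, y) \<in> expansion_feasible \<int>\<^sub>+ \<T> A B d. \<forall>i. adaptive \<T> (\<tau> i) (\<lambda>n. x n $ i)}"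

definition MLP_optimal ::
  "'n stage_tree \<Rightarrow> ('n \<Rightarrow> real^'i) \<Rightarrow> ('n \<Rightarrow> real^'j) \<Rightarrow>
   ('n \<Rightarrow> real^'j^'i) \<Rightarrow> ('n \<Rightarrow> real^'j^'k) \<Rightarrow> ('n \<Rightarrow> real^'k) \<Rightarrow>
   ('n \<Rightarrow> real^'i) \<Rightarrow> ('n \<Rightarrow> real^'j) \<Rightarrow> bool" where
  "MLP_optimal \<T> a b A B d x y \<longleftrightarrow>
     is_arg_min (expansion_cost \<T> a b) (\<lambda>s. s \<in> expansion_feasible \<real>\<^sub>+ \<T> A B d) (x, y)"

definition single_cost :: "'n stage_tree \<Rightarrow> ('n \<Rightarrow> real) \<Rightarrow> ('n \<Rightarrow> real) \<Rightarrow> real" where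
  "single_cost \<T> c z = (\<Sum>n \<in> nodes \<T>. prob \<T> n * c n * z n)"

definition single_feasible :: "real set \<Rightarrow> 'n stage_tree \<Rightarrow> ('n \<Rightarrow> real) \<Rightarrow> ('n \<Rightarrow> real) set" where
  "single_feasible D \<T> \<delta> = {z. \<forall>n \<in> nodes \<T>. \<delta> n \<le> (\<Sum>m \<in> path \<T> n. z m) \<and> z n \<in> D}"

definition v_M :: "'n stage_tree \<Rightarrow> ('n \<Rightarrow> real) \<Rightarrow> ('n \<Rightarrow> real) \<Rightarrow> real" where
  "v_M \<T> c \<delta> = opt_value (single_cost \<T> c) (single_feasible \<real>\<^sub>+ \<T> \<delta>)"

definition v_R :: "'n stage_tree \<Rightarrow> ('n \<Rightarrow> real) \<Rightarrow> ('n \<Rightarrow> real) \<Rightarrow> nat \<Rightarrow> real" where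
  "v_R \<T> c \<delta> \<tau> =
     opt_value (single_cost \<T> c) {z \<in> single_feasible \<real>\<^sub>+ \<T> \<delta>. adaptive \<T> \<tau> z}"

text \<open>A node of the condensed tree is represented by the set of original nodes merged into it.
  The empty set is excluded because a subtree need not reach every later stage.\<close>

definition condensed_nodes :: "'n stage_tree \<Rightarrow> nat \<Rightarrow> 'n set set" where
  "condensed_nodes \<T> \<tau> =
     ({stage \<T> t |t. t < \<tau>} \<union>
      {stage \<T> t \<inter> subtree \<T> j |t j. \<tau> \<le> t \<and> j \<in> stage \<T> \<tau>}) - {{}}"

definition condensed_demand :: "('n \<Rightarrow> real) \<Rightarrow> 'n set \<Rightarrow> real" where
  "condensed_demand \<delta> C = Max (\<delta> ` C)"

definition rounding_gap :: "'n stage_tree \<Rightarrow> nat \<Rightarrow> ('n \<Rightarrow> real) \<Rightarrow> real" where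
  "rounding_gap \<T> \<tau> \<delta> =
     (MAX C \<in> condensed_nodes \<T> \<tau>. real_of_int \<lceil>condensed_demand \<delta> C\<rceil> - condensed_demand \<delta> C)"

end

theory Submission
  imports Defs
begin

text \<open>
  Once the allocation is fixed at \<open>yMLP\<close>, the expansion problem splits into one
  single-resource problem per resource \<open>i\<close>, with demand
  \<open>\<delta> i n = (A n *v yMLP n) $ i\<close>. Both optimal values are compared with what this
  fixed allocation gives.

  The multi-stage value is at least the value of its linear relaxation. That relaxation has
  \<open>yMLP\<close> as an optimal allocation, and the acquisitions \<open>xMLP\<close> that go with it are
  feasible in each relaxed single-resource problem; so \<open>V_MS\<close> is at least the allocation cost
  plus the sum of the \<open>v_M\<close>.

  The adaptive two-stage value is at most the cost of any integral adaptive plan that supports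
  \<open>yMLP\<close>. Such a plan comes, resource by resource, from a nearly optimal plan \<open>z\<close> of the
  relaxed adaptive problem (\<open>exists_integral_adaptive_plan\<close>). The cumulative capacity of \<open>z\<close>
  is constant on every condensed node, hence it covers the largest demand merged there.
  Buying \<open>rounding_gap\<close> more units at the root, which has probability one, lifts it above
  all the rounded-up demands at the additional cost that appears in the bound. It remains to
  make the plan integral for free. For a threshold \<open>\<theta>\<close> in \<open>[0, 1]\<close>, replace the cumulative
  capacity \<open>X n\<close> by \<open>\<lfloor>X n + \<theta>\<rfloor>\<close>, with one common \<open>\<theta>\<close> for the whole tree. This
  preserves monotonicity along paths, constancy on condensed nodes and integral lower bounds.
  Since \<open>\<lfloor>x + \<theta>\<rfloor>\<close> averages to \<open>x\<close> over \<open>[0, 1]\<close>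
  (\<open>has_integral_floor_shift\<close>) and the cost is linear in \<open>X\<close>, the average cost of the rounded
  plans is the cost of the fractional one, so some threshold does not increase it.
\<close>

definition cumulative :: "'n stage_tree \<Rightarrow> ('n \<Rightarrow> real) \<Rightarrow> 'n \<Rightarrow> real" where
  "cumulative \<T> z n = (\<Sum>m \<in> path \<T> n. z m)"

text \<open>This is the inverse of \<^const>\<open>cumulative\<close> on the nodes of a tree. The root is a separate
  case because its \<open>parent\<close> is an arbitrary value.\<close>

definition increments :: "'n stage_tree \<Rightarrow> ('n \<Rightarrow> real) \<Rightarrow> 'n \<Rightarrow> real" where
  "increments \<T> X n = (if n = root_node \<T> then X n else X n - X (parent \<T> n))"

section \<open>Threshold rounding\<close>

text \<open>With \<open>r\<close> the fractional part of \<open>x\<close>, the integrand is \<open>\<lfloor>x\<rfloor>\<close> on an interval of length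
  \<open>1 - r\<close> and \<open>\<lfloor>x\<rfloor> + 1\<close> on the remaining one of length \<open>r\<close>.\<close>

lemma has_integral_floor_shift:
  fixes x :: real
  shows "((\<lambda>\<theta>. real_of_int \<lfloor>x + \<theta>\<rfloor>) has_integral x) {0..1}"
proof -
  define k where "k = real_of_int \<lfloor>x\<rfloor>"
  define r where "r = x - k"
  have r: "0 \<le> r" "r < 1" unfolding r_def k_def by linarith+
  have below: "((\<lambda>\<theta>. real_of_int \<lfloor>x + \<theta>\<rfloor>) has_integral (1 - r) * k) {0..1 - r}"
  proof (rule has_integral_spike_finite)
    show "finite {1 - r}" by simp
    show "((\<lambda>\<theta>. k) has_integral (1 - r) * k) {0..1 - r}"
      using has_integral_const_real[of k 0 "1 - r"] r by simp
    fix \<theta> assume "\<theta> \<in> {0..1 - r} - {1 - r}"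
    then have "0 \<le> \<theta>" "\<theta> < 1 - r" by auto
    then have "\<lfloor>x + \<theta>\<rfloor> = \<lfloor>x\<rfloor>" unfolding floor_eq_iff r_def k_def by linarith
    then show "real_of_int \<lfloor>x + \<theta>\<rfloor> = k" by (simp add: k_def)
  qed
  have above: "((\<lambda>\<theta>. real_of_int \<lfloor>x + \<theta>\<rfloor>) has_integral r * (k + 1)) {1 - r..1}"
  proof (rule has_integral_eq)
    show "((\<lambda>\<theta>. k + 1) has_integral r * (k + 1)) {1 - r..1}"
      using has_integral_const_real[of "k + 1" "1 - r" 1] r by simp
    fix \<theta> assume "\<theta> \<in> {1 - r..1}"
    then have "\<lfloor>x + \<theta>\<rfloor> = \<lfloor>x\<rfloor> + 1"
      using r unfolding floor_eq_iff r_def k_def by simp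
    then show "k + 1 = real_of_int \<lfloor>x + \<theta>\<rfloor>" by (simp add: k_def)
  qed
  have "(1 - r) * k + r * (k + 1) = x" by (simp add: r_def algebra_simps)
  then show ?thesis
    using has_integral_combine[OF _ _ below above] r by simp
qed

section \<open>Paths in a scenario tree\<close>

locale scenario =
  fixes \<T> :: "'n stage_tree"
  assumes scenario_tree: "scenario_tree \<T>"
begin

lemma finite_nodes: "finite (nodes \<T>)"
  and root_in_nodes: "root_node \<T> \<in> nodes \<T>"
  and period_root: "period \<T> (root_node \<T>) = 1"
  and parent_in_nodes: "n \<in> nodes \<T> \<Longrightarrow> n \<noteq> root_node \<T> \<Longrightarrow> parent \<T> n \<in> nodes \<T>"
  and period_parent:
    "n \<in> nodes \<T> \<Longrightarrow> n \<noteq> root_node \<T> \<Longrightarrow> period \<T> n = Suc (period \<T> (parent \<T> n))"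
  and period_pos: "n \<in> nodes \<T> \<Longrightarrow> 0 < period \<T> n"
  and prob_nonneg: "n \<in> nodes \<T> \<Longrightarrow> 0 \<le> prob \<T> n"
  using scenario_tree unfolding scenario_tree_def by (auto simp: Suc_le_eq)

lemma period_1_imp_root: "n \<in> nodes \<T> \<Longrightarrow> period \<T> n = 1 \<Longrightarrow> n = root_node \<T>"
  using period_parent period_pos parent_in_nodes by fastforce

lemma prob_root: "prob \<T> (root_node \<T>) = 1"
proof -
  have root_stage: "stage \<T> 1 = {root_node \<T>}"
    unfolding stage_def using period_1_imp_root root_in_nodes period_root by blast
  have periods: "\<forall>n \<in> nodes \<T>. period \<T> n \<in> {1..stages \<T>}"
    and total: "\<forall>t \<in> {1..stages \<T>}. (\<Sum>n \<in> stage \<T> t. prob \<T> n) = 1"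
    using scenario_tree unfolding scenario_tree_def by simp_all
  have "1 \<in> {1..stages \<T>}"
    using bspec[OF periods root_in_nodes] unfolding period_root .
  from bspec[OF total this] show ?thesis by (simp only: root_stage) simp
qed

lemma node_induct [consumes 1, case_names root step]:
  assumes "n \<in> nodes \<T>"
    and root: "P (root_node \<T>)"
    and step: "\<And>n. n \<in> nodes \<T> \<Longrightarrow> n \<noteq> root_node \<T> \<Longrightarrow> P (parent \<T> n) \<Longrightarrow> P n"
  shows "P n"
  using assms(1)
proof (induction "period \<T> n" arbitrary: n rule: less_induct)
  case less
  then show ?case
    using root step parent_in_nodes period_parent by (metis lessI)
qed

lemma path_root: "path \<T> (root_node \<T>) = {root_node \<T>}"
  by (auto simp: path_def period_root)

lemma path_step:
  assumes "n \<in> nodes \<T>" "n \<noteq> root_node \<T>"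
  shows "path \<T> n = insert n (path \<T> (parent \<T> n))"
proof -
  have "path \<T> v = (\<lambda>k. (parent \<T> ^^ k) v) ` {..<period \<T> v}" for v
    by (auto simp: path_def)
  then show ?thesis
    by (simp add: period_parent[OF assms] lessThan_Suc_eq_insert_0 image_image funpow_Suc_right
        del: funpow.simps)
qed

lemma path_subset_nodes: "n \<in> nodes \<T> \<Longrightarrow> path \<T> n \<subseteq> nodes \<T>"
  by (induction rule: node_induct) (auto simp: path_root path_step root_in_nodes)

lemma period_less_on_path:
  assumes "n \<in> nodes \<T>" "m \<in> path \<T> n"
  shows "m = n \<or> period \<T> m < period \<T> n"
  using assms
proof (induction arbitrary: m rule: node_induct)
  case root
  then show ?case by (simp add: path_root)
next
  case (step n)
  then show ?case using period_parent[of n] by (auto simp: path_step less_Suc_eq)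
qed

lemma finite_path: "n \<in> nodes \<T> \<Longrightarrow> finite (path \<T> n)"
  using path_subset_nodes finite_nodes finite_subset by blast

lemma self_in_path: "n \<in> nodes \<T> \<Longrightarrow> n \<in> path \<T> n"
  using path_step path_root by blast

lemma root_in_path: "n \<in> nodes \<T> \<Longrightarrow> root_node \<T> \<in> path \<T> n"
  by (induction rule: node_induct) (auto simp: path_root path_step)

lemma cumulative_root: "cumulative \<T> z (root_node \<T>) = z (root_node \<T>)"
  by (simp add: cumulative_def path_root)

lemma cumulative_step:
  assumes "n \<in> nodes \<T>" "n \<noteq> root_node \<T>"
  shows "cumulative \<T> z n = z n + cumulative \<T> z (parent \<T> n)"
proof -
  have "n \<notin> path \<T> (parent \<T> n)"
    using assms parent_in_nodes period_less_on_path period_parent by (metis lessI not_less_iff_gr_or_eq)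
  then show ?thesis
    using assms finite_path parent_in_nodes by (simp add: cumulative_def path_step)
qed

lemma increments_cumulative: "n \<in> nodes \<T> \<Longrightarrow> increments \<T> (cumulative \<T> z) n = z n"
  by (simp add: increments_def cumulative_root cumulative_step)

lemma cumulative_increments: "n \<in> nodes \<T> \<Longrightarrow> cumulative \<T> (increments \<T> X) n = X n"
  by (induction rule: node_induct) (simp_all add: cumulative_root cumulative_step increments_def)

section \<open>Condensed nodes\<close>

text \<open>In this form the adaptive constraints no longer distinguish the periods before the revision
  from those after it, and they pass to any function that is computed node by node.\<close>

lemma adaptive_iff_constant_on_condensed:
  "adaptive \<T> \<tau> z \<longleftrightarrow> (\<forall>C \<in> condensed_nodes \<T> \<tau>. \<forall>m \<in> C. \<forall>n \<in> C. z m = z n)"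
  unfolding adaptive_def condensed_nodes_def by blast

lemma condensed_subset_nodes: "C \<in> condensed_nodes \<T> \<tau> \<Longrightarrow> C \<subseteq> nodes \<T>"
  by (auto simp: condensed_nodes_def stage_def)

lemma condensed_same_period:
  "C \<in> condensed_nodes \<T> \<tau> \<Longrightarrow> m \<in> C \<Longrightarrow> n \<in> C \<Longrightarrow> period \<T> m = period \<T> n"
  by (auto simp: condensed_nodes_def stage_def)

lemma finite_condensed_nodes: "finite (condensed_nodes \<T> \<tau>)"
  using finite_nodes condensed_subset_nodes by (meson PowI finite_Pow_iff finite_subset subsetI)

text \<open>This places every node of period at least \<open>\<tau>\<close> in one of the subtrees whose stages are
  merged after the revision.\<close>

lemma ancestor_at_period:
  assumes "n \<in> nodes \<T>" "1 \<le> \<tau>" "\<tau> \<le> period \<T> n"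
  shows "\<exists>j \<in> stage \<T> \<tau>. n \<in> subtree \<T> j"
proof -
  have "\<exists>j \<in> stage \<T> \<tau>. j \<in> path \<T> n"
    using assms(1,3)
  proof (induction rule: node_induct)
    case root
    then show ?case using assms(2) period_root root_in_nodes by (auto simp: path_root stage_def)
  next
    case (step n)
    show ?case
    proof (cases "period \<T> n = \<tau>")
      case True
      then show ?thesis using step.hyps self_in_path by (auto simp: stage_def)
    next
      case False
      then have "\<tau> \<le> period \<T> (parent \<T> n)"
        using step.prems period_parent[OF step.hyps] by linarith
      then show ?thesis using step.IH path_step[OF step.hyps] by auto
    qed
  qed
  then show ?thesis using assms(1) by (auto simp: subtree_def)
qed

lemma node_in_condensed:
  assumes "n \<in> nodes \<T>" "1 \<le> \<tau>"
  shows "\<exists>C \<in> condensed_nodes \<T> \<tau>. n \<in> C"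
proof (cases "period \<T> n < \<tau>")
  case True
  then have "stage \<T> (period \<T> n) \<in> condensed_nodes \<T> \<tau>" "n \<in> stage \<T> (period \<T> n)"
    using assms by (auto simp: condensed_nodes_def stage_def)
  then show ?thesis by blast
next
  case False
  then obtain j where "j \<in> stage \<T> \<tau>" "n \<in> subtree \<T> j"
    using ancestor_at_period assms by (meson not_less)
  moreover have "n \<in> stage \<T> (period \<T> n)" using assms by (simp add: stage_def)
  ultimately have "stage \<T> (period \<T> n) \<inter> subtree \<T> j \<in> condensed_nodes \<T> \<tau>"
    "n \<in> stage \<T> (period \<T> n) \<inter> subtree \<T> j"
    using False unfolding condensed_nodes_def not_less by blast+
  then show ?thesis by blast
qed

text \<open>This is what makes the condensed tree a tree: edges of the original tree induce edges between
  merged nodes. At the revision period \<open>\<tau>\<close> the condensed nodes are singletons, so two distinct nodes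
  merged inside a subtree have period greater than \<open>\<tau>\<close>, and their parents stay in that subtree.\<close>

lemma condensed_parents:
  assumes C: "C \<in> condensed_nodes \<T> \<tau>" "m \<in> C" "n \<in> C"
    and "m \<noteq> root_node \<T>" "n \<noteq> root_node \<T>" "m \<noteq> n"
  shows "\<exists>C' \<in> condensed_nodes \<T> \<tau>. parent \<T> m \<in> C' \<and> parent \<T> n \<in> C'"
proof -
  have nodes: "m \<in> nodes \<T>" "n \<in> nodes \<T>" using condensed_subset_nodes C by auto
  note parents = parent_in_nodes[OF nodes(1) assms(4)] parent_in_nodes[OF nodes(2) assms(5)]
    period_parent[OF nodes(1) assms(4)] period_parent[OF nodes(2) assms(5)]
  consider (before) t where "t < \<tau>" "C = stage \<T> t"
    | (after) t j where "\<tau> \<le> t" "j \<in> stage \<T> \<tau>" "C = stage \<T> t \<inter> subtree \<T> j"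
    using C(1) by (auto simp: condensed_nodes_def)
  then show ?thesis
  proof cases
    case before
    then have "{parent \<T> m, parent \<T> n} \<subseteq> stage \<T> (t - 1)" "t - 1 < \<tau>"
      using C parents by (auto simp: stage_def)
    then show ?thesis unfolding condensed_nodes_def by blast
  next
    case after
    have j: "j \<in> path \<T> m" "j \<in> path \<T> n" "period \<T> j = \<tau>" "period \<T> m = t" "period \<T> n = t"
      using after C by (auto simp: subtree_def stage_def)
    have "j \<noteq> m" "j \<noteq> n"
      using j period_less_on_path nodes \<open>m \<noteq> n\<close> by (metis less_irrefl)+
    then have above: "j \<in> path \<T> (parent \<T> m)" "j \<in> path \<T> (parent \<T> n)"
      using j nodes assms(4,5) by (auto simp: path_step)
    have "\<tau> < t"
      using \<open>j \<noteq> m\<close> j period_less_on_path nodes by metis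
    then have "{parent \<T> m, parent \<T> n} \<subseteq> stage \<T> (t - 1) \<inter> subtree \<T> j" "\<tau> \<le> t - 1"
      using above parents j by (auto simp: stage_def subtree_def)
    then show ?thesis using after(2) unfolding condensed_nodes_def by blast
  qed
qed

lemma condensed_root:
  assumes "C \<in> condensed_nodes \<T> \<tau>" "root_node \<T> \<in> C" "n \<in> C"
  shows "n = root_node \<T>"
  using assms condensed_same_period condensed_subset_nodes period_1_imp_root period_root
  by (metis subsetD)

text \<open>Constancy on condensed nodes therefore passes between a plan and its cumulative capacity, in
  both directions: each is determined along a path by the values at a node and at its parent.\<close>

lemma adaptive_increments:
  assumes "adaptive \<T> \<tau> X"
  shows "adaptive \<T> \<tau> (increments \<T> X)"
  unfolding adaptive_iff_constant_on_condensed
proof (intro ballI)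
  fix C m n assume C: "C \<in> condensed_nodes \<T> \<tau>" "m \<in> C" "n \<in> C"
  show "increments \<T> X m = increments \<T> X n"
  proof (cases "m = n \<or> m = root_node \<T> \<or> n = root_node \<T>")
    case True
    then show ?thesis using condensed_root C by metis
  next
    case False
    then have "X (parent \<T> m) = X (parent \<T> n)"
      using assms condensed_parents[OF C] unfolding adaptive_iff_constant_on_condensed by metis
    moreover have "X m = X n"
      using assms C unfolding adaptive_iff_constant_on_condensed by metis
    ultimately show ?thesis using False by (simp add: increments_def)
  qed
qed

lemma adaptive_cumulative:
  assumes "adaptive \<T> \<tau> z"
  shows "adaptive \<T> \<tau> (cumulative \<T> z)"
proof -
  have "\<forall>C n. C \<in> condensed_nodes \<T> \<tau> \<longrightarrow> m \<in> C \<longrightarrow> n \<in> C \<longrightarrow> cumulative \<T> z m = cumulative \<T> z n"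
    if "m \<in> nodes \<T>" for m
    using that
  proof (induction rule: node_induct)
    case root
    then show ?case using condensed_root by metis
  next
    case (step m)
    show ?case
    proof (intro allI impI)
      fix C n assume C: "C \<in> condensed_nodes \<T> \<tau>" "m \<in> C" "n \<in> C"
      have "n \<in> nodes \<T>" using C condensed_subset_nodes by blast
      have "n \<noteq> root_node \<T>" using condensed_root C step.hyps by metis
      show "cumulative \<T> z m = cumulative \<T> z n"
      proof (cases "m = n")
        case False
        then have "cumulative \<T> z (parent \<T> m) = cumulative \<T> z (parent \<T> n)"
          using condensed_parents[OF C step.hyps(2) \<open>n \<noteq> root_node \<T>\<close>] step.IH by metis
        moreover have "z m = z n"
          using assms C unfolding adaptive_iff_constant_on_condensed by metis
        ultimately show ?thesis
          using step.hyps \<open>n \<in> nodes \<T>\<close> \<open>n \<noteq> root_node \<T>\<close> by (simp add: cumulative_step)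
      qed simp
    qed
  qed
  then show ?thesis
    using condensed_subset_nodes unfolding adaptive_iff_constant_on_condensed by blast
qed

section \<open>Rounding a single-resource plan\<close>

lemma single_cost_nonneg:
  assumes "\<And>n. n \<in> nodes \<T> \<Longrightarrow> 0 \<le> c n" "z \<in> single_feasible \<real>\<^sub>+ \<T> \<delta>"
  shows "0 \<le> single_cost \<T> c z"
  using assms prob_nonneg unfolding single_cost_def single_feasible_def
  by (auto intro!: sum_nonneg mult_nonneg_nonneg)

lemma single_cost_cong:
  "(\<And>n. n \<in> nodes \<T> \<Longrightarrow> z n = z' n) \<Longrightarrow> single_cost \<T> c z = single_cost \<T> c z'"
  by (simp add: single_cost_def)

lemma has_integral_rounded_cost:
  "((\<lambda>\<theta>. single_cost \<T> c (increments \<T> (\<lambda>n. real_of_int \<lfloor>X n + \<theta>\<rfloor>)))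
     has_integral single_cost \<T> c (increments \<T> X)) {0..1}"
  unfolding single_cost_def
proof (rule has_integral_sum[OF finite_nodes], rule has_integral_mult_right)
  fix n
  show "((\<lambda>\<theta>. increments \<T> (\<lambda>n. real_of_int \<lfloor>X n + \<theta>\<rfloor>) n) has_integral increments \<T> X n) {0..1}"
    by (simp add: increments_def has_integral_floor_shift has_integral_diff)
qed

text \<open>Some rounded plan is at least as good as the average. A strict bound \<open>K\<close> makes this follow from
  monotonicity of the integral alone: rounded costs that were all at least \<open>K\<close> would average to at
  least \<open>K\<close>.\<close>

lemma exists_cheap_threshold:
  assumes "single_cost \<T> c (increments \<T> X) < K"
  shows "\<exists>\<theta> \<in> {0..1}. single_cost \<T> c (increments \<T> (\<lambda>n. real_of_int \<lfloor>X n + \<theta>\<rfloor>)) < K"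
proof (rule ccontr)
  assume "\<not> ?thesis"
  then have "K \<le> single_cost \<T> c (increments \<T> (\<lambda>n. real_of_int \<lfloor>X n + \<theta>\<rfloor>))"
    if "\<theta> \<in> {0..1}" for \<theta> using that by force
  moreover have "((\<lambda>\<theta>. K) has_integral K) {0..1::real}"
    using has_integral_const_real[of K 0 1] by simp
  ultimately have "K \<le> single_cost \<T> c (increments \<T> X)"
    using has_integral_le has_integral_rounded_cost by blast
  then show False using assms by simp
qed

text \<open>Rounding cumulative capacities with a common threshold is monotone, so capacity never has to be
  given back; rounding the acquisitions separately would not control their sums.\<close>

lemma increments_rounded:
  assumes z: "\<And>n. n \<in> nodes \<T> \<Longrightarrow> 0 \<le> z n" and "0 \<le> \<theta>" and n: "n \<in> nodes \<T>"
  shows "increments \<T> (\<lambda>n. real_of_int \<lfloor>cumulative \<T> z n + \<theta>\<rfloor>) n \<in> \<int>\<^sub>+"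
proof (cases "n = root_node \<T>")
  case True
  then show ?thesis using assms by (simp add: increments_def cumulative_root)
next
  case False
  then have "cumulative \<T> z (parent \<T> n) \<le> cumulative \<T> z n"
    using z n by (simp add: cumulative_step)
  then have "\<lfloor>cumulative \<T> z (parent \<T> n) + \<theta>\<rfloor> \<le> \<lfloor>cumulative \<T> z n + \<theta>\<rfloor>"
    by (intro floor_mono) simp
  then show ?thesis using False by (simp add: increments_def)
qed

lemma ceiling_gap_le_rounding_gap:
  assumes "C \<in> condensed_nodes \<T> \<tau>"
  shows "real_of_int \<lceil>condensed_demand \<delta> C\<rceil> - condensed_demand \<delta> C \<le> rounding_gap \<T> \<tau> \<delta>"
  unfolding rounding_gap_def using finite_condensed_nodes assms by (intro Max_ge) auto

lemma rounding_gap_nonneg: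
  assumes "1 \<le> \<tau>"
  shows "0 \<le> rounding_gap \<T> \<tau> \<delta>"
proof -
  obtain C where "C \<in> condensed_nodes \<T> \<tau>"
    using node_in_condensed root_in_nodes assms by blast
  from ceiling_gap_le_rounding_gap[OF this, of \<delta>] show ?thesis
    using le_of_int_ceiling[of "condensed_demand \<delta> C"] by linarith
qed

text \<open>The price of integrality is paid once, at the root: the extra units bought there cover the
  rounded-up demands, and the threshold rounding that follows preserves the cost on average.\<close>

lemma exists_integral_adaptive_plan:
  assumes \<tau>: "1 \<le> \<tau>"
    and z: "z \<in> single_feasible \<real>\<^sub>+ \<T> \<delta>" "adaptive \<T> \<tau> z"
    and K: "single_cost \<T> c z + rounding_gap \<T> \<tau> \<delta> * c (root_node \<T>) < K"
  shows "\<exists>w \<in> single_feasible \<int>\<^sub>+ \<T> \<delta>. adaptive \<T> \<tau> w \<and> single_cost \<T> c w < K"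
proof -
  define g where "g = rounding_gap \<T> \<tau> \<delta>"
  \<comment> \<open>All cumulative capacities rise by \<open>g\<close>, because every path starts at the root.\<close>
  define u where "u n = z n + (if n = root_node \<T> then g else 0)" for n
  have g: "0 \<le> g" unfolding g_def using rounding_gap_nonneg \<tau> .
  have u_nonneg: "0 \<le> u n" if "n \<in> nodes \<T>" for n
    using z(1) g that by (auto simp: u_def single_feasible_def)
  have cumulative_u: "cumulative \<T> u n = cumulative \<T> z n + g" if "n \<in> nodes \<T>" for n
    using that
    by (simp add: cumulative_def u_def sum.distrib sum.delta finite_path root_in_path)
  have "adaptive \<T> \<tau> u"
    unfolding adaptive_iff_constant_on_condensed
  proof (intro ballI)
    fix C m n assume C: "C \<in> condensed_nodes \<T> \<tau>" "m \<in> C" "n \<in> C"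
    then have "m = root_node \<T> \<longleftrightarrow> n = root_node \<T>" using condensed_root by blast
    moreover have "z m = z n" using z(2) C unfolding adaptive_iff_constant_on_condensed by blast
    ultimately show "u m = u n" by (simp add: u_def)
  qed
  then have adaptive_u: "adaptive \<T> \<tau> (cumulative \<T> u)" by (rule adaptive_cumulative)
  have covers: "real_of_int \<lceil>condensed_demand \<delta> C\<rceil> \<le> cumulative \<T> u n"
    if C: "C \<in> condensed_nodes \<T> \<tau>" "n \<in> C" for C n
  proof -
    have nodes: "C \<subseteq> nodes \<T>" "n \<in> nodes \<T>" using condensed_subset_nodes C by auto
    have "cumulative \<T> z m = cumulative \<T> z n" if "m \<in> C" for m
      using adaptive_cumulative[OF z(2)] that C unfolding adaptive_iff_constant_on_condensed by blast
    moreover have "\<delta> m \<le> cumulative \<T> z m" if "m \<in> C" for m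
      using z(1) that nodes by (auto simp: single_feasible_def cumulative_def)
    ultimately have "\<forall>m \<in> C. \<delta> m \<le> cumulative \<T> z n" by metis
    moreover have "finite C" using nodes(1) finite_nodes finite_subset by blast
    ultimately have "condensed_demand \<delta> C \<le> cumulative \<T> z n"
      unfolding condensed_demand_def using C(2) by (intro Max.boundedI) auto
    then show ?thesis
      using ceiling_gap_le_rounding_gap[OF C(1), of \<delta>] cumulative_u[OF nodes(2)]
      by (simp add: g_def)
  qed
  have "single_cost \<T> c u = single_cost \<T> c z + g * c (root_node \<T>)"
    using finite_nodes root_in_nodes prob_root
    by (simp add: single_cost_def u_def distrib_left sum.distrib if_distrib[of "\<lambda>x. _ * x"]
        sum.delta cong: if_cong)
  moreover have "single_cost \<T> c (increments \<T> (cumulative \<T> u)) = single_cost \<T> c u"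
    by (rule single_cost_cong) (rule increments_cumulative)
  ultimately have "single_cost \<T> c (increments \<T> (cumulative \<T> u)) < K"
    using K by (simp add: g_def)
  then obtain \<theta> where \<theta>: "\<theta> \<in> {0..1}" and
    cheap: "single_cost \<T> c (increments \<T> (\<lambda>n. real_of_int \<lfloor>cumulative \<T> u n + \<theta>\<rfloor>)) < K"
    using exists_cheap_threshold by blast
  define Y where "Y n = real_of_int \<lfloor>cumulative \<T> u n + \<theta>\<rfloor>" for n
  have "adaptive \<T> \<tau> Y"
    using adaptive_u unfolding adaptive_iff_constant_on_condensed Y_def by metis
  then have "adaptive \<T> \<tau> (increments \<T> Y)" by (rule adaptive_increments)
  moreover have "single_cost \<T> c (increments \<T> Y) < K" using cheap by (simp add: Y_def[abs_def])
  moreover have "increments \<T> Y \<in> single_feasible \<int>\<^sub>+ \<T> \<delta>"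
    unfolding single_feasible_def
  proof (rule CollectI, intro ballI conjI)
    fix n assume n: "n \<in> nodes \<T>"
    obtain C where C: "C \<in> condensed_nodes \<T> \<tau>" "n \<in> C"
      using node_in_condensed n \<tau> by blast
    have "finite C" using condensed_subset_nodes[OF C(1)] finite_nodes finite_subset by blast
    then have "\<delta> n \<le> condensed_demand \<delta> C"
      unfolding condensed_demand_def using C(2) by simp
    also have "\<dots> \<le> \<lceil>condensed_demand \<delta> C\<rceil>" by simp
    \<comment> \<open>The lower bound is an integer, so it survives rounding the larger capacity down.\<close>
    also have "\<dots> \<le> Y n"
      using covers[OF C] \<theta> by (simp add: Y_def le_floor_iff)
    also have "Y n = (\<Sum>m \<in> path \<T> n. increments \<T> Y m)"
      using cumulative_increments[OF n, of Y] by (simp add: cumulative_def)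
    finally show "\<delta> n \<le> (\<Sum>m \<in> path \<T> n. increments \<T> Y m)" .
    show "increments \<T> Y n \<in> \<int>\<^sub>+"
      using increments_rounded[of u \<theta> n] u_nonneg \<theta> n by (simp add: Y_def[abs_def])
  qed
  ultimately show ?thesis by blast
qed

text \<open>Buying the largest demand at the root is feasible and adaptive. Without a feasible plan the
  infimum defining \<^const>\<open>v_R\<close> would be an arbitrary number.\<close>

lemma single_feasible_adaptive_nonempty:
  "{z \<in> single_feasible \<real>\<^sub>+ \<T> \<delta>. adaptive \<T> \<tau> z} \<noteq> {}"
proof -
  define M where "M = Max (insert 0 (\<delta> ` nodes \<T>))"
  define z where "z n = (if n = root_node \<T> then M else 0)" for n
  have M: "0 \<le> M" "\<And>n. n \<in> nodes \<T> \<Longrightarrow> \<delta> n \<le> M"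
    unfolding M_def using finite_nodes by auto
  have "z \<in> single_feasible \<real>\<^sub>+ \<T> \<delta>"
    using M by (auto simp: single_feasible_def z_def sum.delta finite_path root_in_path)
  moreover have "adaptive \<T> \<tau> z"
    using condensed_root unfolding adaptive_iff_constant_on_condensed z_def by metis
  ultimately show ?thesis by blast
qed

text \<open>The slack \<open>\<epsilon>\<close> replaces attainment of the infimum in \<^const>\<open>v_R\<close>.\<close>

lemma v_R_rounding:
  assumes "1 \<le> \<tau>" "0 < \<epsilon>"
  shows "\<exists>w \<in> single_feasible \<int>\<^sub>+ \<T> \<delta>. adaptive \<T> \<tau> w \<and>
    single_cost \<T> c w < v_R \<T> c \<delta> \<tau> + rounding_gap \<T> \<tau> \<delta> * c (root_node \<T>) + \<epsilon>"
proof -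
  define F where "F = {z \<in> single_feasible \<real>\<^sub>+ \<T> \<delta>. adaptive \<T> \<tau> z}"
  have "Inf (single_cost \<T> c ` F) < v_R \<T> c \<delta> \<tau> + \<epsilon>"
    using assms(2) by (simp add: v_R_def opt_value_def F_def)
  then obtain z where "z \<in> F" "single_cost \<T> c z < v_R \<T> c \<delta> \<tau> + \<epsilon>"
    using cInf_lessD[of "single_cost \<T> c ` F"] single_feasible_adaptive_nonempty
    unfolding F_def by blast
  then show ?thesis
    using exists_integral_adaptive_plan[OF assms(1), of z \<delta> c] by (auto simp: F_def)
qed

lemma v_M_le:
  assumes "\<And>n. n \<in> nodes \<T> \<Longrightarrow> 0 \<le> c n" "z \<in> single_feasible \<real>\<^sub>+ \<T> \<delta>"
  shows "v_M \<T> c \<delta> \<le> single_cost \<T> c z"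
  unfolding v_M_def opt_value_def
  using assms single_cost_nonneg by (intro cINF_lower bdd_belowI2[where m = 0]) auto

section \<open>Capacity expansion with a fixed allocation\<close>

lemma expansion_cost_decompose:
  "expansion_cost \<T> a b (x, y) =
     (\<Sum>n \<in> nodes \<T>. prob \<T> n * (b n \<bullet> y n)) + (\<Sum>i\<in>UNIV. single_cost \<T> (\<lambda>n. a n $ i) (\<lambda>n. x n $ i))"
  for a :: "'n \<Rightarrow> real^'i" and b :: "'n \<Rightarrow> real^'j"
  unfolding single_cost_def
  by (subst sum.swap)
     (simp add: expansion_cost_def inner_vec_def distrib_left sum.distrib sum_distrib_left mult.assoc)

lemma expansion_feasible_iff:
  "(x, y) \<in> expansion_feasible D \<T> A B d \<longleftrightarrow>
     (\<forall>i. (\<lambda>n. x n $ i) \<in> single_feasible D \<T> (\<lambda>n. (A n *v y n) $ i)) \<and>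
     (\<forall>n \<in> nodes \<T>. d n \<le> B n *v y n \<and> (\<forall>j. y n $ j \<in> \<real>\<^sub>+))"
  for A :: "'n \<Rightarrow> real^'j^'i" and B :: "'n \<Rightarrow> real^'j^'k"
  unfolding expansion_feasible_def single_feasible_def less_eq_vec_def by auto

lemma expansion_feasible_integral_imp_real:
  "expansion_feasible \<int>\<^sub>+ \<T> A B d \<subseteq> expansion_feasible \<real>\<^sub>+ \<T> A B d"
  by (auto simp: expansion_feasible_def)

lemma expansion_cost_nonneg:
  fixes a :: "'n \<Rightarrow> real^'i" and b :: "'n \<Rightarrow> real^'j"
    and A :: "'n \<Rightarrow> real^'j^'i" and B :: "'n \<Rightarrow> real^'j^'k"
  assumes "\<And>n. n \<in> nodes \<T> \<Longrightarrow> 0 \<le> a n" "\<And>n. n \<in> nodes \<T> \<Longrightarrow> 0 \<le> b n"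
    and "s \<in> expansion_feasible \<real>\<^sub>+ \<T> A B d"
  shows "0 \<le> expansion_cost \<T> a b s"
  using assms prob_nonneg
  by (auto simp: expansion_cost_def expansion_feasible_def inner_vec_def less_eq_vec_def
      intro!: sum_nonneg mult_nonneg_nonneg add_nonneg_nonneg)

text \<open>Feasibility is assumed because an infimum over the empty set would be an arbitrary number.\<close>

lemma V_MS_ge_relaxation:
  assumes feasible: "expansion_feasible \<int>\<^sub>+ \<T> A B d \<noteq> {}" and opt: "MLP_optimal \<T> a b A B d x y"
  shows "expansion_cost \<T> a b (x, y) \<le> V_MS \<T> a b A B d"
  unfolding V_MS_def opt_value_def
  using opt expansion_feasible_integral_imp_real
  by (intro cINF_greatest[OF feasible]) (force simp: MLP_optimal_def is_arg_min_def not_less)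

end

theorem proposition7:
  fixes \<T> :: "'n stage_tree"
    and a :: "'n \<Rightarrow> real^'i" and b :: "'n \<Rightarrow> real^'j" and d :: "'n \<Rightarrow> real^'k"
    and A :: "'n \<Rightarrow> real^'j^'i" and B :: "'n \<Rightarrow> real^'j^'k"
    and tstar :: "'i \<Rightarrow> nat"
    and xMLP :: "'n \<Rightarrow> real^'i" and yMLP :: "'n \<Rightarrow> real^'j"
    and \<delta> :: "'i \<Rightarrow> 'n \<Rightarrow> real"
  assumes "scenario_tree \<T>"
    and "\<And>n. n \<in> nodes \<T> \<Longrightarrow> 0 \<le> a n"
    and "\<And>n. n \<in> nodes \<T> \<Longrightarrow> 0 \<le> b n"
    and "\<And>n. n \<in> nodes \<T> \<Longrightarrow> 0 \<le> d n"
    and "\<And>i. tstar i \<in> {1..stages \<T>}"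
    and "MLP_optimal \<T> a b A B d xMLP yMLP"
    and "\<And>i n. \<delta> i n = (A n *v yMLP n) $ i"
  shows "V_ATS \<T> a b A B d tstar - V_MS \<T> a b A B d
    \<le> (\<Sum>i\<in>UNIV. v_R \<T> (\<lambda>n. a n $ i) (\<delta> i) (tstar i) - v_M \<T> (\<lambda>n. a n $ i) (\<delta> i)
         + rounding_gap \<T> (tstar i) (\<delta> i) * a (root_node \<T>) $ i)"
proof -
  interpret scenario \<T> by unfold_locales (rule assms(1))
  define allocation_cost where "allocation_cost = (\<Sum>n \<in> nodes \<T>. prob \<T> n * (b n \<bullet> yMLP n))"
  define upper where "upper i = v_R \<T> (\<lambda>n. a n $ i) (\<delta> i) (tstar i)
      + rounding_gap \<T> (tstar i) (\<delta> i) * a (root_node \<T>) $ i" for i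
  have \<delta>: "\<delta> i = (\<lambda>n. (A n *v yMLP n) $ i)" for i using assms(7) by auto
  have a_nonneg: "0 \<le> a n $ i" if "n \<in> nodes \<T>" for n i
    using assms(2)[OF that] by (simp add: less_eq_vec_def)
  have MLP: "(xMLP, yMLP) \<in> expansion_feasible \<real>\<^sub>+ \<T> A B d"
    using assms(6) by (auto simp: MLP_optimal_def is_arg_min_def)
  have plan: "\<exists>x. (x, yMLP) \<in> expansion_feasible \<int>\<^sub>+ \<T> A B d \<and>
      (\<forall>i. adaptive \<T> (tstar i) (\<lambda>n. x n $ i)) \<and>
      expansion_cost \<T> a b (x, yMLP) \<le> allocation_cost + (\<Sum>i\<in>UNIV. upper i + \<epsilon>)"
    if "0 < \<epsilon>" for \<epsilon>
  proof -
    have "\<exists>w. w \<in> single_feasible \<int>\<^sub>+ \<T> (\<delta> i) \<and> adaptive \<T> (tstar i) w \<and>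
        single_cost \<T> (\<lambda>n. a n $ i) w < upper i + \<epsilon>" for i
      using v_R_rounding[of "tstar i" \<epsilon> "\<delta> i" "\<lambda>n. a n $ i"] assms(5)[of i] that
      unfolding upper_def by auto
    then obtain w where w: "\<And>i. w i \<in> single_feasible \<int>\<^sub>+ \<T> (\<delta> i)"
      "\<And>i. adaptive \<T> (tstar i) (w i)" "\<And>i. single_cost \<T> (\<lambda>n. a n $ i) (w i) < upper i + \<epsilon>"
      by metis
    define x where "x n = (\<chi> i. w i n)" for n
    have x: "(\<lambda>n. x n $ i) = w i" for i by (simp add: x_def)
    have "(x, yMLP) \<in> expansion_feasible \<int>\<^sub>+ \<T> A B d"
      using MLP w(1) unfolding expansion_feasible_iff x \<delta> by blast
    moreover have "expansion_cost \<T> a b (x, yMLP) \<le> allocation_cost + (\<Sum>i\<in>UNIV. upper i + \<epsilon>)"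
      unfolding expansion_cost_decompose x allocation_cost_def
      using w(3) by (intro add_left_mono sum_mono less_imp_le)
    ultimately show ?thesis using w(2) x by auto
  qed
  have ATS: "V_ATS \<T> a b A B d tstar \<le> allocation_cost + (\<Sum>i\<in>UNIV. upper i)"
  proof (rule field_le_epsilon)
    fix e :: real assume "0 < e"
    \<comment> \<open>The error is spread evenly over the resources.\<close>
    define \<epsilon> where "\<epsilon> = e / CARD('i)"
    have "0 < \<epsilon>" using \<open>0 < e\<close> by (simp add: \<epsilon>_def)
    from plan[OF this] obtain x where x:
      "(x, yMLP) \<in> expansion_feasible \<int>\<^sub>+ \<T> A B d" "\<forall>i. adaptive \<T> (tstar i) (\<lambda>n. x n $ i)"
      "expansion_cost \<T> a b (x, yMLP) \<le> allocation_cost + (\<Sum>i\<in>UNIV. upper i + \<epsilon>)" by blast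
    have "V_ATS \<T> a b A B d tstar \<le> expansion_cost \<T> a b (x, yMLP)"
      unfolding V_ATS_def opt_value_def
    proof (rule cINF_lower)
      show "bdd_below (expansion_cost \<T> a b ` {(x, y) \<in> expansion_feasible \<int>\<^sub>+ \<T> A B d.
          \<forall>i. adaptive \<T> (tstar i) (\<lambda>n. x n $ i)})"
      proof (rule bdd_belowI2[where m = 0])
        fix s assume "s \<in> {(x, y) \<in> expansion_feasible \<int>\<^sub>+ \<T> A B d.
          \<forall>i. adaptive \<T> (tstar i) (\<lambda>n. x n $ i)}"
        then have "s \<in> expansion_feasible \<real>\<^sub>+ \<T> A B d"
          using expansion_feasible_integral_imp_real by blast
        then show "0 \<le> expansion_cost \<T> a b s"
          using expansion_cost_nonneg assms(2,3) by blast
      qed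
    qed (use x in auto)
    then show "V_ATS \<T> a b A B d tstar \<le> allocation_cost + (\<Sum>i\<in>UNIV. upper i) + e"
      using x(3) by (simp add: sum.distrib \<epsilon>_def)
  qed
  have "(\<Sum>i\<in>UNIV. v_M \<T> (\<lambda>n. a n $ i) (\<delta> i))
      \<le> (\<Sum>i\<in>UNIV. single_cost \<T> (\<lambda>n. a n $ i) (\<lambda>n. xMLP n $ i))"
    using MLP a_nonneg unfolding expansion_feasible_iff \<delta> by (intro sum_mono v_M_le) auto
  then have "allocation_cost + (\<Sum>i\<in>UNIV. v_M \<T> (\<lambda>n. a n $ i) (\<delta> i))
      \<le> expansion_cost \<T> a b (xMLP, yMLP)"
    by (simp add: expansion_cost_decompose allocation_cost_def)
  \<comment> \<open>The rounded plan for any \<open>\<epsilon>\<close> also shows that the integral problem is feasible.\<close>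
  also have "\<dots> \<le> V_MS \<T> a b A B d"
    using V_MS_ge_relaxation[OF _ assms(6)] plan[of 1] by auto
  finally have "V_ATS \<T> a b A B d tstar - V_MS \<T> a b A B d
      \<le> (\<Sum>i\<in>UNIV. upper i) - (\<Sum>i\<in>UNIV. v_M \<T> (\<lambda>n. a n $ i) (\<delta> i))"
    using ATS by linarith
  then show ?thesis
    by (simp add: upper_def sum.distrib sum_subtractf)
qed

end
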